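(* Let $\lambda$ be a nonzero real number and let $u\in\mathbb{C}$ with $u\neq 1$. Let $p(x)\in\mathbb{C}[x]$ with $\deg p(x)=n$, and let $f(t)=\frac{1}{\lambda}(e^{\lambda t}-1)$. Then $p(x)=\sum_{k=0}^{n}a_k\, h_{k,\lambda}(x|u)$, where for $k=0,1,\dots,n$, \begin{align*} a_k&=\frac{1}{(1-u)k!}\,(f(t))^{k}\big(p(x+1)-up(x)\big)\Big|_{x=0}\\ &=\frac{1}{(1-u)k!\,\lambda^{k}}\big\langle (e^{\lambda t}-1)^{k}\,\big|\, p(x+1)-up(x)\big\rangle\\ &=\frac{1}{(1-u)k!\,\lambda^{k}}\Big(\Delta_{\lambda}^{k}\tilde{\Delta}p(0)-(1+u)\Delta_{\lambda}^{k}p(0)\Big)\\ &=\frac{1}{(1-u)k!\,\lambda^{k}}\sum_{j=0}^{k}\binom{k}{j}(-1)^{k-j}\big(p(1+j\lambda)-up(j\lambda)\big)\\ &=\frac{1}{1-u}\sum_{l=k}^{n}S_2(l,k)\frac{\lambda^{l-k}}{l!}\big(p^{(l)}(1)-up^{(l)}(0)\big). \end{align*}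
   Context: The degenerate exponential is $e_\lambda^x(t)=(1+\lambda t)^{x/\lambda}=\sum_{n\ge0}(x)_{n,\lambda}\frac{t^n}{n!}$, with $e_\lambda(t)=e_\lambda^1(t)$. The degenerate Frobenius-Euler polynomials $h_{n,\lambda}(x|u)$ are defined by $\frac{1-u}{e_\lambda(t)-u}e_\lambda^x(t)=\sum_{n\ge0}h_{n,\lambda}(x|u)\frac{t^n}{n!}$. A formal power series $F(t)=\sum_k c_k t^k/k!$ acts on polynomials as a differential operator via $t^k x^m=(m)_k x^{m-k}$ (i.e. $t=d/dx$), so $e^{yt}q(x)=q(x+y)$; and as a linear functional via $\langle F(t)\,|\,q(x)\rangle=(F(t)q(x))|_{x=0}$, in particular $\langle t^k|x^m\rangle=m!\delta_{m,k}$. For a polynomial $q$: $\Delta_\lambda q(x)=q(x+\lambda)-q(x)$, $\Delta_\lambda^k q(x)=\sum_{i=0}^k\binom{k}{i}(-1)^{k-i}q(x+i\lambda)$, $\tilde{\Delta}q(x)=q(x+1)+q(x)$; $\Delta_\lambda^k\tilde\Delta p(0)$ means $(\Delta_\lambda^k\tilde\Delta p)(x)$ at $x=0$. $p^{(l)}$ is the $l$-th derivative. $S_2(l,k)$ are Stirling numbers of the second kind, $\frac{1}{k!}(e^t-1)^k=\sum_{l\ge k}S_2(l,k)\frac{t^l}{l!}$. *)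

theory Defs
  imports
    Complex_Main
    "HOL-Computational_Algebra.Computational_Algebra"
    "HOL-Combinatorics.Stirling"
begin

section \<open>Degenerate exponentials and Frobenius-Euler polynomials\<close>

definition degenerate_falling :: "complex \<Rightarrow> nat \<Rightarrow> complex poly" where
  "degenerate_falling l n = (\<Prod>i<n. [:- (of_nat i * l), 1:])"

definition degenerate_exp :: "complex \<Rightarrow> complex \<Rightarrow> complex fps" where
  "degenerate_exp l x = Abs_fps (\<lambda>n. poly (degenerate_falling l n) x / fact n)"

text \<open>The degenerate exponential with \<open>x\<close> kept as a polynomial indeterminate.\<close>

definition degenerate_exp_poly :: "complex \<Rightarrow> complex poly fps" where
  "degenerate_exp_poly l = Abs_fps (\<lambda>n. smult (1 / fact n) (degenerate_falling l n))"

text \<open>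
  The quotient \<open>(1 - u) / (e\<^sub>l(t) - u)\<close> does not involve \<open>x\<close>. It is formed over the complex
  numbers, where the denominator is a unit for \<open>u \<noteq> 1\<close>, and then embedded coefficientwise into
  the power series over \<open>complex poly\<close>.
\<close>

definition frobenius_euler :: "nat \<Rightarrow> complex \<Rightarrow> complex \<Rightarrow> complex poly" where
  "frobenius_euler n l u = smult (fact n)
     (fps_nth
       (Abs_fps (\<lambda>m. [:fps_nth (fps_const (1 - u) / (degenerate_exp l 1 - fps_const u)) m:])
          * degenerate_exp_poly l) n)"

lemma degenerate_exp_binomial:
  assumes "l \<noteq> 0"
  shows "degenerate_exp l x = fps_binomial (x / l) oo (fps_const l * fps_X)"
proof (rule fps_ext)
  fix n
  have "(\<Prod>i<n. x - of_nat i * l) = (\<Prod>i<n. l * (x / l - of_nat i))"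
    using assms by (intro prod.cong) (auto simp: field_simps)
  also have "\<dots> = l ^ n * (\<Prod>i<n. x / l - of_nat i)"
    by (simp add: prod.distrib)
  finally show "fps_nth (degenerate_exp l x) n =
      fps_nth (fps_binomial (x / l) oo (fps_const l * fps_X)) n"
    by (simp add: degenerate_exp_def degenerate_falling_def poly_prod fps_compose_linear
        gbinomial_prod_rev atLeast0LessThan)
qed

lemma frobenius_euler_gf:
  "Abs_fps (\<lambda>n. poly (frobenius_euler n l u) x / fact n) =
     fps_const (1 - u) / (degenerate_exp l 1 - fps_const u) * degenerate_exp l x"
  by (rule fps_ext)
     (simp add: frobenius_euler_def fps_mult_nth poly_sum degenerate_exp_def
       degenerate_exp_poly_def)

section \<open>Power series as operators and functionals on polynomials\<close>

text \<open>
  The series \<open>\<Sum>k. c\<^sub>k t\<^sup>k / k!\<close> has \<open>c\<^sub>k / k!\<close> as its coefficient of \<open>t\<^sup>k\<close>, and \<open>t\<close> acts as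
  \<open>d/dx\<close>. Derivatives of order above the degree vanish, so the sum is finite.
\<close>

definition fps_act :: "complex fps \<Rightarrow> complex poly \<Rightarrow> complex poly" where
  "fps_act F q = (\<Sum>k\<le>degree q. smult (fps_nth F k) ((pderiv ^^ k) q))"

definition fps_functional :: "complex fps \<Rightarrow> complex poly \<Rightarrow> complex" where
  "fps_functional F q = poly (fps_act F q) 0"

section \<open>Difference operators\<close>

definition poly_translate :: "complex \<Rightarrow> complex poly \<Rightarrow> complex poly" where
  "poly_translate c q = pcompose q [:c, 1:]"

definition Delta :: "complex \<Rightarrow> complex poly \<Rightarrow> complex poly" where
  "Delta l q = poly_translate l q - q"

definition Delta_tilde :: "complex poly \<Rightarrow> complex poly" where
  "Delta_tilde q = poly_translate 1 q + q"

lemma poly_poly_translate [simp]: "poly (poly_translate c q) x = poly q (x + c)"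
  by (simp add: poly_translate_def poly_pcompose add.commute)

lemma poly_Delta_funpow:
  "poly ((Delta l ^^ k) q) x =
     (\<Sum>i\<le>k. of_nat (k choose i) * (-1) ^ (k - i) * poly q (x + of_nat i * l))"
proof (induction k arbitrary: x)
  case (Suc k)
  let ?g = "\<lambda>i. (-1) ^ (Suc k - i) * poly q (x + of_nat i * l)"
  have A: "poly ((Delta l ^^ k) q) (x + l) = (\<Sum>i\<le>k. of_nat (k choose i) * ?g (Suc i))"
    unfolding Suc.IH by (intro sum.cong) (auto simp: algebra_simps)
  have B: "- poly ((Delta l ^^ k) q) x = (\<Sum>i\<le>k. of_nat (k choose i) * ?g i)"
    unfolding Suc.IH sum_negf[symmetric] by (intro sum.cong) (auto simp: Suc_diff_le)
  also have "\<dots> = (\<Sum>i\<le>Suc k. of_nat (k choose i) * ?g i)"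
    by simp
  also have "\<dots> = ?g 0 + (\<Sum>i\<le>k. of_nat (k choose Suc i) * ?g (Suc i))"
    by (subst sum.atMost_Suc_shift) simp
  finally have B: "- poly ((Delta l ^^ k) q) x = \<dots>" .
  have "poly ((Delta l ^^ Suc k) q) x =
      poly ((Delta l ^^ k) q) (x + l) + - poly ((Delta l ^^ k) q) x"
    by (simp add: Delta_def)
  also have "\<dots> = ?g 0 + (\<Sum>i\<le>k. of_nat (Suc k choose Suc i) * ?g (Suc i))"
    unfolding A B by (simp add: sum.distrib[symmetric] distrib_right)
  also have "\<dots> = (\<Sum>i\<le>Suc k. of_nat (Suc k choose i) * ?g i)"
    by (subst sum.atMost_Suc_shift) simp
  finally show ?case by (simp add: mult.assoc)
qed simp

section \<open>Stirling numbers of the second kind\<close>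

lemma Stirling_egf:
  "fps_const (1 / fact k) * (fps_exp 1 - 1) ^ k =
     Abs_fps (\<lambda>l. of_nat (Stirling l k) / fact l :: complex)"
proof (rule fps_ext)
  fix n
  define F :: "nat \<Rightarrow> complex fps"
    where "F = (\<lambda>k. fps_const (1 / fact k) * (fps_exp 1 - 1) ^ k)"
  have deriv: "fps_deriv (F (Suc k)) = F k + of_nat (Suc k) * F (Suc k)" for k
  proof -
    have c: "fps_const (1 / fact (Suc k) :: complex) * of_nat (Suc k) = fps_const (1 / fact k)"
      unfolding fps_of_nat[symmetric] fps_const_mult by (simp add: field_simps del: of_nat_Suc)
    have "fps_deriv (F (Suc k)) =
        (fps_const (1 / fact (Suc k)) * of_nat (Suc k)) * (fps_exp 1 - 1) ^ k * fps_exp 1"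
      by (simp add: F_def fps_deriv_power fps_of_nat algebra_simps del: of_nat_Suc power_Suc fact_Suc)
    also have "\<dots> = F k * fps_exp 1"
      unfolding c F_def ..
    also have "\<dots> = F k + F k * (fps_exp 1 - 1)"
      by (simp add: algebra_simps)
    also have "F k * (fps_exp 1 - 1) =
        (fps_const (1 / fact (Suc k)) * of_nat (Suc k)) * (fps_exp 1 - 1) ^ Suc k"
      unfolding c by (simp add: F_def mult_ac)
    also have "\<dots> = of_nat (Suc k) * F (Suc k)"
      by (simp only: F_def mult_ac)
    finally show ?thesis .
  qed
  have "fps_nth (F k) n = of_nat (Stirling n k) / fact n"
  proof (induction n arbitrary: k)
    case 0
    then show ?case by (cases k) (auto simp: F_def fps_power_zeroth)
  next
    case (Suc n)
    show ?case
    proof (cases k)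
      case 0
      then show ?thesis by (simp add: F_def)
    next
      case (Suc m)
      have "of_nat (Suc n) * fps_nth (F (Suc m)) (Suc n) = fps_nth (fps_deriv (F (Suc m))) n"
        by simp
      also have "\<dots> = fps_nth (F m) n + of_nat (Suc m) * fps_nth (F (Suc m)) n"
        unfolding deriv fps_of_nat[symmetric] by (simp del: of_nat_Suc)
      also have "\<dots> = of_nat (Stirling (Suc n) (Suc m)) / fact n"
        unfolding Suc.IH by (simp add: add_divide_distrib algebra_simps)
      finally show ?thesis
        unfolding Suc by (simp add: field_simps del: of_nat_Suc Stirling.simps)
    qed
  qed
  then show "fps_nth (fps_const (1 / fact k) * (fps_exp 1 - 1) ^ k) n =
      fps_nth (Abs_fps (\<lambda>l. of_nat (Stirling l k) / fact l :: complex)) n"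
    by (simp add: F_def)
qed

end

theory Submission
  imports Defs
begin

text \<open>
  The operator \<open>T p(x) = p(x + 1) - u p(x)\<close> acts on \<open>e\<^sub>\<lambda>\<^sup>x(t)\<close> as multiplication by \<open>e\<^sub>\<lambda>(t) - u\<close>,
  so it sends \<open>h\<^sub>k\<^sub>,\<^sub>\<lambda>(x|u)\<close> to \<open>(1 - u)(x)\<^sub>k\<^sub>,\<^sub>\<lambda>\<close>. As \<open>T\<close> is injective, expanding \<open>p\<close> in the
  polynomials \<open>h\<^sub>k\<^sub>,\<^sub>\<lambda>(x|u)\<close> amounts to expanding \<open>T p\<close> in the degenerate falling factorials, which
  is Newton interpolation with step \<open>\<lambda>\<close> at \<open>0\<close>. The formulas for the coefficients are evaluations
  of \<open>\<Delta>\<^sub>\<lambda>\<^sup>k T p(0)\<close>.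
\<close>

text \<open>At 0 only the constant term of the k-th derivative survives, and it is k! times the k-th
  coefficient. The summation bound is free because for \<open>T p\<close> only an upper bound on the
  degree is established.\<close>

lemma fps_functional_coeff:
  assumes "degree q \<le> n"
  shows "fps_functional F q = (\<Sum>k\<le>n. fact k * fps_nth F k * coeff q k)"
proof -
  have "fps_functional F q = (\<Sum>k\<le>degree q. fact k * fps_nth F k * coeff q k)"
    by (simp add: fps_functional_def fps_act_def poly_0_coeff_0 coeff_sum coeff_higher_pderiv
        pochhammer_fact[symmetric] mult_ac)
  also have "\<dots> = (\<Sum>k\<le>n. fact k * fps_nth F k * coeff q k)"
    using assms by (intro sum.mono_neutral_left) (auto intro: coeff_eq_0)
  finally show ?thesis .
qed

lemma fps_functional_const_mult: "fps_functional (fps_const c * F) q = c * fps_functional F q"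
  by (simp add: fps_functional_coeff[OF order_refl] sum_distrib_left mult_ac)

lemma fps_functional_sum: "fps_functional (\<Sum>i\<in>A. F i) q = (\<Sum>i\<in>A. fps_functional (F i) q)"
  unfolding fps_functional_coeff[OF order_refl] fps_sum_nth sum_distrib_left sum_distrib_right
  by (rule sum.swap)

lemma fps_functional_exp: "fps_functional (fps_exp c) q = poly q c"
  by (simp add: fps_functional_coeff[OF order_refl] poly_altdef mult_ac)

text \<open>After binomial expansion each \<open>fps_exp (of_nat i * c)\<close> acts as evaluation
  at \<open>of_nat i * c\<close>, which reproduces the explicit sum for iterated differences at
  0.\<close>

lemma fps_functional_exp_minus_1_power:
  "fps_functional ((fps_exp c - 1) ^ k) q = poly ((Delta c ^^ k) q) 0"
proof -
  have "(fps_exp c - 1) ^ k = (fps_exp c + fps_const (-1)) ^ k"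
    by (simp flip: fps_const_neg)
  also have "\<dots> = (\<Sum>i\<le>k. fps_const (of_nat (k choose i) * (-1) ^ (k - i)) * fps_exp (of_nat i * c))"
    by (simp add: binomial_ring fps_exp_power_mult fps_const_power fps_of_nat mult_ac
        flip: fps_const_mult)
  finally show ?thesis
    by (simp add: fps_functional_sum fps_functional_const_mult fps_functional_exp poly_Delta_funpow)
qed

text \<open>This is the Stirling generating function after the substitution of c t for t, the source
  of the factor \<open>c ^ j\<close>.\<close>

lemma fps_exp_minus_1_power_nth:
  fixes c :: complex
  shows "fps_nth ((fps_exp c - 1) ^ k) j = fact k * of_nat (Stirling j k) / fact j * c ^ j"
proof -
  have "(fps_exp 1 - 1 :: complex fps) ^ k = fps_const (fact k) * (fps_const (1 / fact k) * (fps_exp 1 - 1) ^ k)"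
    by (simp flip: mult.assoc)
  also have "\<dots> = fps_const (fact k) * Abs_fps (\<lambda>l. of_nat (Stirling l k) / fact l)"
    by (simp only: Stirling_egf)
  finally have S: "fps_nth ((fps_exp 1 - 1 :: complex fps) ^ k) j = fact k * of_nat (Stirling j k) / fact j"
    by simp
  have "fps_exp c - 1 = (fps_exp 1 - 1) oo (fps_const c * fps_X)"
    by (rule fps_ext) (simp add: fps_compose_linear)
  then have "(fps_exp c - 1) ^ k = (fps_exp 1 - 1) ^ k oo (fps_const c * fps_X)"
    by (simp add: fps_compose_power)
  then show ?thesis
    by (simp add: fps_compose_linear S)
qed

lemma higher_pderiv_poly_translate:
  "(pderiv ^^ k) (poly_translate c p) = poly_translate c ((pderiv ^^ k) p)"
  by (induction k) (simp_all add: poly_translate_def pderiv_pcompose pderiv_pCons)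

lemma higher_pderiv_diff:
  fixes p q :: "'a::idom poly"
  shows "(pderiv ^^ k) (p - q) = (pderiv ^^ k) p - (pderiv ^^ k) q"
  by (induction k) (simp_all add: pderiv_diff)

text \<open>Translation keeps the leading coefficient, so the operator scales the coefficient at
  \<open>degree r\<close> by the nonzero factor 1 - u. This is the injectivity of T.\<close>

lemma poly_translate_1_diff_smult_eq_0:
  assumes "u \<noteq> 1" and "poly_translate 1 r - smult u r = 0"
  shows "r = 0"
proof -
  have "coeff (poly_translate 1 r) (degree r) = lead_coeff r"
    using lead_coeff_comp[of "[:1, 1::complex:]" r]
    by (simp add: poly_translate_def degree_pcompose)
  with assms(2) have "(1 - u) * lead_coeff r = 0"
    by (metis coeff_0 coeff_diff coeff_smult left_diff_distrib mult_1)
  with assms(1) show ?thesis by simp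
qed

lemma degenerate_exp_add:
  assumes "l \<noteq> 0"
  shows "degenerate_exp l (x + y) = degenerate_exp l x * degenerate_exp l y"
  by (simp add: degenerate_exp_binomial[OF assms] add_divide_distrib fps_binomial_add_mult
      fps_compose_mult_distrib)

lemma poly_translate_frobenius_euler:
  assumes "l \<noteq> 0" and "u \<noteq> 1"
  shows "poly_translate 1 (frobenius_euler k l u) - smult u (frobenius_euler k l u) =
    smult (1 - u) (degenerate_falling l k)"
proof (rule poly_ext)
  fix x
  let ?G = "\<lambda>x. Abs_fps (\<lambda>n. poly (frobenius_euler n l u) x / fact n)"
  let ?E = "degenerate_exp l 1 - fps_const u"
  \<comment> \<open>The constant term is 1 - u, so \<open>?E\<close> is a unit and the quotient
    really cancels.\<close>
  have "fps_nth ?E 0 \<noteq> 0"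
    using assms(2) by (simp add: degenerate_exp_def degenerate_falling_def)
  then have E: "fps_const (1 - u) / ?E * ?E = fps_const (1 - u)"
    by (simp add: fps_divide_unit inverse_mult_eq_1 mult.assoc)
  \<comment> \<open>Replacing x by x + 1 multiplies the generating function by
    \<open>degenerate_exp l 1\<close>; subtracting u times the original leaves the factor
    \<open>?E\<close>.\<close>
  have "?G (x + 1) - fps_const u * ?G x = fps_const (1 - u) / ?E * ?E * degenerate_exp l x"
    unfolding frobenius_euler_gf degenerate_exp_add[OF assms(1)] by (simp add: algebra_simps)
  also have "\<dots> = fps_const (1 - u) * degenerate_exp l x"
    by (simp only: E)
  finally have "fps_nth (?G (x + 1) - fps_const u * ?G x) k =
      fps_nth (fps_const (1 - u) * degenerate_exp l x) k"
    by (simp only:)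
  then show "poly (poly_translate 1 (frobenius_euler k l u) - smult u (frobenius_euler k l u)) x =
      poly (smult (1 - u) (degenerate_falling l k)) x"
    by (simp add: degenerate_exp_def flip: diff_divide_distrib)
qed

text \<open>The shift by l is 1 + \<open>Delta l\<close>, so this is the binomial expansion of its
  j-th power, proved by Pascal's rule.\<close>

lemma poly_shift_eq_sum_Delta:
  "poly q (x + of_nat j * l) = (\<Sum>k\<le>j. of_nat (j choose k) * poly ((Delta l ^^ k) q) x)"
proof (induction j arbitrary: x)
  case (Suc j)
  let ?d = "\<lambda>k. poly ((Delta l ^^ k) q) x"
  have "poly q (x + of_nat (Suc j) * l) = poly q ((x + l) + of_nat j * l)"
    by (simp add: algebra_simps)
  also have "\<dots> = (\<Sum>k\<le>j. of_nat (j choose k) * ?d (Suc k)) + (\<Sum>k\<le>j. of_nat (j choose k) * ?d k)"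
    unfolding Suc.IH by (simp add: Delta_def sum.distrib[symmetric] algebra_simps)
  \<comment> \<open>The added term is zero; it lets the k = 0 term be split off and the rest
    reindexed to match the other sum.\<close>
  also have "(\<Sum>k\<le>j. of_nat (j choose k) * ?d k) = (\<Sum>k\<le>Suc j. of_nat (j choose k) * ?d k)"
    by simp
  also have "\<dots> = ?d 0 + (\<Sum>k\<le>j. of_nat (j choose Suc k) * ?d (Suc k))"
    by (subst sum.atMost_Suc_shift) simp
  also have "(\<Sum>k\<le>j. of_nat (j choose k) * ?d (Suc k)) +
      (?d 0 + (\<Sum>k\<le>j. of_nat (j choose Suc k) * ?d (Suc k))) =
      ?d 0 + (\<Sum>k\<le>j. of_nat (Suc j choose Suc k) * ?d (Suc k))"
    by (simp add: sum.distrib distrib_right)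
  also have "\<dots> = (\<Sum>k\<le>Suc j. of_nat (Suc j choose k) * ?d k)"
    by (subst sum.atMost_Suc_shift) simp
  finally show ?case .
qed simp

lemma degree_degenerate_falling: "degree (degenerate_falling l k) = k"
  by (simp add: degenerate_falling_def degree_prod_eq_sum_degree)

lemma poly_degenerate_falling_multiple:
  "poly (degenerate_falling l k) (of_nat j * l) = of_nat (j choose k) * (fact k * l ^ k)"
proof -
  have "poly (degenerate_falling l k) (of_nat j * l) = (\<Prod>i<k. (of_nat j - of_nat i) * l)"
    by (simp add: degenerate_falling_def poly_prod algebra_simps)
  also have "\<dots> = (\<Prod>i<k. of_nat j - of_nat i) * l ^ k"
    by (simp add: prod.distrib)
  also have "(\<Prod>i<k. of_nat j - of_nat i) = fact k * (of_nat (j choose k) :: complex)"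
    by (simp add: binomial_gbinomial gbinomial_prod_rev atLeast0LessThan)
  finally show ?thesis by simp
qed

text \<open>Both sides have degree at most n and agree at the n + 1 nodes 0, l, ..., n l, which are
  distinct because l is nonzero.\<close>

lemma newton_degenerate_falling:
  assumes "l \<noteq> 0" and "degree q \<le> n"
  shows "q = (\<Sum>k\<le>n. smult (poly ((Delta l ^^ k) q) 0 / (fact k * l ^ k)) (degenerate_falling l k))"
    (is "q = ?r")
proof (rule poly_eqI_degree)
  let ?A = "(\<lambda>j. of_nat j * l) ` {..n}"
  have inj: "inj_on (\<lambda>j. of_nat j * l) {..n}"
    using assms(1) by (auto simp: inj_on_def)
  have "degree ?r \<le> n"
    by (intro degree_sum_le) (auto intro: order_trans[OF degree_smult_le] simp: degree_degenerate_falling)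
  then show "degree ?r < card ?A" "degree q < card ?A"
    using assms(2) by (simp_all add: card_image[OF inj])
  fix x assume "x \<in> ?A"
  then obtain j where j: "j \<le> n" and x: "x = of_nat j * l" by auto
  have "poly q x = (\<Sum>k\<le>j. of_nat (j choose k) * poly ((Delta l ^^ k) q) 0)"
    using poly_shift_eq_sum_Delta[of q 0 j l] by (simp add: x)
  \<comment> \<open>The binomial coefficients vanish for k > j, so all nodes share one range of
    summation.\<close>
  also have "\<dots> = (\<Sum>k\<le>n. of_nat (j choose k) * poly ((Delta l ^^ k) q) 0)"
    using j by (intro sum.mono_neutral_left) auto
  also have "\<dots> = poly ?r x"
    using assms(1) by (simp add: poly_sum x poly_degenerate_falling_multiple)
      (simp add: mult.commute)
  finally show "poly q x = poly ?r x" .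
qed

theorem theorem3p1:
  fixes l :: real and u :: complex and p :: "complex poly" and n :: nat and f :: "complex fps"
  assumes "l \<noteq> 0" and "u \<noteq> 1" and "degree p = n"
    and "f = fps_const (1 / complex_of_real l) * (fps_exp (complex_of_real l) - 1)"
  shows "\<exists>a :: nat \<Rightarrow> complex.
    p = (\<Sum>k\<le>n. smult (a k) (frobenius_euler k (complex_of_real l) u)) \<and>
    (\<forall>k\<le>n.
      a k = 1 / ((1 - u) * fact k) * poly (fps_act (f ^ k) (poly_translate 1 p - smult u p)) 0 \<and>
      a k = 1 / ((1 - u) * fact k * complex_of_real l ^ k) *
        fps_functional ((fps_exp (complex_of_real l) - 1) ^ k) (poly_translate 1 p - smult u p) \<and>
      a k = 1 / ((1 - u) * fact k * complex_of_real l ^ k) *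
        (poly ((Delta (complex_of_real l) ^^ k) (Delta_tilde p)) 0
          - (1 + u) * poly ((Delta (complex_of_real l) ^^ k) p) 0) \<and>
      a k = 1 / ((1 - u) * fact k * complex_of_real l ^ k) *
        (\<Sum>j = 0..k. of_nat (k choose j) * (-1) ^ (k - j) *
          (poly p (1 + of_nat j * complex_of_real l) - u * poly p (of_nat j * complex_of_real l))) \<and>
      a k = 1 / (1 - u) *
        (\<Sum>j = k..n. of_nat (Stirling j k) * (complex_of_real l ^ (j - k) / fact j) *
          (poly ((pderiv ^^ j) p) 1 - u * poly ((pderiv ^^ j) p) 0)))"
proof -
  define L where "L = complex_of_real l"
  have L: "L \<noteq> 0" using assms(1) by (simp add: L_def)
  define T where "T = (\<lambda>p. poly_translate 1 p - smult u p)"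
  have T_sum: "T (\<Sum>k\<le>n. smult (a k) (r k)) = (\<Sum>k\<le>n. smult (a k) (T (r k)))"
    for a and r :: "nat \<Rightarrow> complex poly"
    by (rule poly_ext) (simp add: T_def poly_sum sum_distrib_left sum_subtractf algebra_simps)
  have deg: "degree (T p) \<le> n"
    using assms(3) unfolding T_def
    by (intro degree_diff_le) (auto simp: poly_translate_def degree_pcompose)
  \<comment> \<open>These are the Newton coefficients of \<open>T p\<close> divided by 1 - u, the
    factor that T produces on each Frobenius-Euler polynomial.\<close>
  define a where "a = (\<lambda>k. poly ((Delta L ^^ k) (T p)) 0 / ((1 - u) * fact k * L ^ k))"
  have func: "a k = 1 / ((1 - u) * fact k * L ^ k) * fps_functional ((fps_exp L - 1) ^ k) (T p)" for k
    by (simp add: a_def fps_functional_exp_minus_1_power)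
  have expand: "a k = 1 / ((1 - u) * fact k * L ^ k) *
      (\<Sum>j\<le>k. of_nat (k choose j) * (-1) ^ (k - j) * (poly p (1 + of_nat j * L) - u * poly p (of_nat j * L)))" for k
    by (simp add: a_def poly_Delta_funpow T_def add.commute)
  have "T p = (\<Sum>k\<le>n. smult (a k) (T (frobenius_euler k L u)))"
    using newton_degenerate_falling[OF L deg] assms(2)
    by (simp add: T_def poly_translate_frobenius_euler[OF L assms(2)] a_def)
  then have "T (p - (\<Sum>k\<le>n. smult (a k) (frobenius_euler k L u))) = 0"
    unfolding T_sum[symmetric]
    by (simp add: T_def poly_translate_def pcompose_diff smult_diff_right algebra_simps)
  then have "p = (\<Sum>k\<le>n. smult (a k) (frobenius_euler k L u))"
    using poly_translate_1_diff_smult_eq_0[OF assms(2)] unfolding T_def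
    by (metis eq_iff_diff_eq_0)
  moreover have "a k = 1 / ((1 - u) * fact k) * poly (fps_act (f ^ k) (T p)) 0" for k
  proof -
    have "f ^ k = fps_const (1 / L ^ k) * (fps_exp L - 1) ^ k"
      by (simp add: assms(4) L_def power_mult_distrib fps_const_power power_divide)
    then show ?thesis
      unfolding func fps_functional_def[symmetric] by (simp add: fps_functional_const_mult)
  qed
  moreover have "a k = 1 / ((1 - u) * fact k * L ^ k) *
      (poly ((Delta L ^^ k) (Delta_tilde p)) 0 - (1 + u) * poly ((Delta L ^^ k) p) 0)" for k
    \<comment> \<open>The termwise comparison rests on \<open>T p\<close> being
      \<open>Delta_tilde p\<close> minus (1 + u) p.\<close>
    unfolding expand poly_Delta_funpow sum_distrib_left[of "1 + u"] sum_subtractf[symmetric]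
    by (intro arg_cong2[of _ _ _ _ "(*)"] sum.cong) (auto simp: Delta_tilde_def algebra_simps)
  moreover have "a k = 1 / (1 - u) * (\<Sum>j = k..n. of_nat (Stirling j k) * (L ^ (j - k) / fact j) *
      (poly ((pderiv ^^ j) p) 1 - u * poly ((pderiv ^^ j) p) 0))" for k
  proof -
    let ?d = "\<lambda>j. poly ((pderiv ^^ j) p) 1 - u * poly ((pderiv ^^ j) p) 0"
    \<comment> \<open>Differentiation commutes with translation, so the Taylor coefficients of
      \<open>T p\<close> at 0 involve the derivatives of p at 1 and at 0.\<close>
    have d: "fact j * coeff (T p) j = ?d j" for j
    proof -
      have "fact j * coeff (T p) j = poly ((pderiv ^^ j) (T p)) 0"
        by (simp add: poly_0_coeff_0 coeff_higher_pderiv pochhammer_fact[symmetric])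
      also have "\<dots> = ?d j"
        by (simp add: T_def higher_pderiv_diff higher_pderiv_smult higher_pderiv_poly_translate)
      finally show ?thesis .
    qed
    have "fps_functional ((fps_exp L - 1) ^ k) (T p) =
        (\<Sum>j\<le>n. fact k * of_nat (Stirling j k) / fact j * L ^ j * ?d j)"
      unfolding fps_functional_coeff[OF deg] fps_exp_minus_1_power_nth d[symmetric]
      by (simp add: mult_ac)
    \<comment> \<open>Stirling numbers vanish for j < k; on the remaining range \<open>L ^ k\<close>
      can be factored out of \<open>L ^ j\<close>.\<close>
    also have "\<dots> = (\<Sum>j = k..n. fact k * of_nat (Stirling j k) / fact j * L ^ j * ?d j)"
      by (intro sum.mono_neutral_right) auto
    also have "\<dots> = (\<Sum>j = k..n. fact k * L ^ k * (of_nat (Stirling j k) * (L ^ (j - k) / fact j) * ?d j))"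
      by (intro sum.cong) (auto simp flip: power_add)
    also have "\<dots> = fact k * L ^ k * (\<Sum>j = k..n. of_nat (Stirling j k) * (L ^ (j - k) / fact j) * ?d j)"
      by (rule sum_distrib_left[symmetric])
    finally show ?thesis
      unfolding func using L by simp
  qed
  ultimately show ?thesis
    using func expand unfolding L_def T_def by (intro exI[of _ a]) (simp add: atLeast0AtMost)
qed

end
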